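(* The category $\mathrm{nsSet}$ of non-singular simplicial sets does not admit a subobject classifier $t\colon\Delta[0]\to\Omega$; hence $\mathrm{nsSet}$ is not a topos.
   Context: A simplicial set $X$ is non-singular if for each $n\ge0$ and each non-degenerate simplex $x\in X_n$ the representing map $\bar x\colon\Delta[n]\to X$ (corresponding to $x$ under the Yoneda lemma) is degreewise injective. $\mathrm{nsSet}$ denotes the full subcategory of the category of simplicial sets on the non-singular simplicial sets; its terminal object is $\Delta[0]$. "Topos" means elementary topos: a category with finite limits that is cartesian closed and has a subobject classifier. *)

theory Defs
  imports Main "HOL-Library.FuncSet"
begin

section \<open>Categories\<close>

record ('o, 'm) cat =
  Obj :: "'o set"
  Arr :: "'m set"
  Dom :: "'m \<Rightarrow> 'o"
  Cod :: "'m \<Rightarrow> 'o"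
  Id :: "'o \<Rightarrow> 'm"
  Comp :: "'m \<Rightarrow> 'm \<Rightarrow> 'm"  (* Comp C g f is g after f *)

definition hom :: "('o, 'm) cat \<Rightarrow> 'o \<Rightarrow> 'o \<Rightarrow> 'm set" where
  "hom C X Y = {f \<in> Arr C. Dom C f = X \<and> Cod C f = Y}"

definition category :: "('o, 'm) cat \<Rightarrow> bool" where
  "category C \<longleftrightarrow>
     (\<forall>f\<in>Arr C. Dom C f \<in> Obj C \<and> Cod C f \<in> Obj C) \<and>
     (\<forall>X\<in>Obj C. Id C X \<in> hom C X X) \<and>
     (\<forall>X Y Z. \<forall>f\<in>hom C X Y. \<forall>g\<in>hom C Y Z. Comp C g f \<in> hom C X Z) \<and>
     (\<forall>X Y. \<forall>f\<in>hom C X Y. Comp C f (Id C X) = f \<and> Comp C (Id C Y) f = f) \<and>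
     (\<forall>W X Y Z. \<forall>f\<in>hom C W X. \<forall>g\<in>hom C X Y. \<forall>h\<in>hom C Y Z.
        Comp C h (Comp C g f) = Comp C (Comp C h g) f)"

definition full_subcategory :: "('o, 'm) cat \<Rightarrow> ('o \<Rightarrow> bool) \<Rightarrow> ('o, 'm) cat" where
  "full_subcategory C P =
     C\<lparr>Obj := {X \<in> Obj C. P X}, Arr := {f \<in> Arr C. P (Dom C f) \<and> P (Cod C f)}\<rparr>"

definition terminal :: "('o, 'm) cat \<Rightarrow> 'o \<Rightarrow> bool" where
  "terminal C T \<longleftrightarrow> T \<in> Obj C \<and> (\<forall>X\<in>Obj C. \<exists>!f. f \<in> hom C X T)"

definition mono_arrow :: "('o, 'm) cat \<Rightarrow> 'm \<Rightarrow> bool" where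
  "mono_arrow C m \<longleftrightarrow> m \<in> Arr C \<and>
     (\<forall>X. \<forall>f\<in>hom C X (Dom C m). \<forall>g\<in>hom C X (Dom C m). Comp C m f = Comp C m g \<longrightarrow> f = g)"

text \<open>\<open>pullback_square C f g p q\<close>: the square \<open>f p = g q\<close> is a pullback of the cospan \<open>f, g\<close>.\<close>

definition pullback_square :: "('o, 'm) cat \<Rightarrow> 'm \<Rightarrow> 'm \<Rightarrow> 'm \<Rightarrow> 'm \<Rightarrow> bool" where
  "pullback_square C f g p q \<longleftrightarrow>
     f \<in> Arr C \<and> g \<in> Arr C \<and> Cod C f = Cod C g \<and>
     p \<in> hom C (Dom C p) (Dom C f) \<and> q \<in> hom C (Dom C p) (Dom C g) \<and>
     Comp C f p = Comp C g q \<and>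
     (\<forall>X. \<forall>u\<in>hom C X (Dom C f). \<forall>v\<in>hom C X (Dom C g). Comp C f u = Comp C g v \<longrightarrow>
        (\<exists>!h. h \<in> hom C X (Dom C p) \<and> Comp C p h = u \<and> Comp C q h = v))"

definition subobject_classifier :: "('o, 'm) cat \<Rightarrow> 'o \<Rightarrow> 'o \<Rightarrow> 'm \<Rightarrow> bool" where
  "subobject_classifier C T \<Omega> t \<longleftrightarrow>
     terminal C T \<and> t \<in> hom C T \<Omega> \<and>
     (\<forall>m. mono_arrow C m \<longrightarrow>
        (\<exists>!\<chi>. \<chi> \<in> hom C (Cod C m) \<Omega> \<and>
              (\<exists>u\<in>hom C (Dom C m) T. pullback_square C \<chi> t m u)))"

definition is_functor ::
  "('j, 'k) cat \<Rightarrow> ('o, 'm) cat \<Rightarrow> ('j \<Rightarrow> 'o) \<Rightarrow> ('k \<Rightarrow> 'm) \<Rightarrow> bool" where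
  "is_functor J C F0 F1 \<longleftrightarrow>
     (\<forall>i\<in>Obj J. F0 i \<in> Obj C \<and> F1 (Id J i) = Id C (F0 i)) \<and>
     (\<forall>i j. \<forall>a\<in>hom J i j. F1 a \<in> hom C (F0 i) (F0 j)) \<and>
     (\<forall>i j k. \<forall>a\<in>hom J i j. \<forall>b\<in>hom J j k. F1 (Comp J b a) = Comp C (F1 b) (F1 a))"

definition cone ::
  "('j, 'k) cat \<Rightarrow> ('o, 'm) cat \<Rightarrow> ('j \<Rightarrow> 'o) \<Rightarrow> ('k \<Rightarrow> 'm) \<Rightarrow> 'o \<Rightarrow> ('j \<Rightarrow> 'm) \<Rightarrow> bool" where
  "cone J C F0 F1 L p \<longleftrightarrow> L \<in> Obj C \<and>
     (\<forall>i\<in>Obj J. p i \<in> hom C L (F0 i)) \<and>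
     (\<forall>i j. \<forall>a\<in>hom J i j. Comp C (F1 a) (p i) = p j)"

definition limit_cone ::
  "('j, 'k) cat \<Rightarrow> ('o, 'm) cat \<Rightarrow> ('j \<Rightarrow> 'o) \<Rightarrow> ('k \<Rightarrow> 'm) \<Rightarrow> 'o \<Rightarrow> ('j \<Rightarrow> 'm) \<Rightarrow> bool" where
  "limit_cone J C F0 F1 L p \<longleftrightarrow> cone J C F0 F1 L p \<and>
     (\<forall>M q. cone J C F0 F1 M q \<longrightarrow>
        (\<exists>!h. h \<in> hom C M L \<and> (\<forall>i\<in>Obj J. Comp C (p i) h = q i)))"

text \<open>Every finite category is isomorphic to one whose objects and arrows are natural numbers,
  so these suffice as index categories.\<close>

definition has_finite_limits :: "('o, 'm) cat \<Rightarrow> bool" where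
  "has_finite_limits C \<longleftrightarrow>
     (\<forall>(J :: (nat, nat) cat) F0 F1.
        category J \<and> finite (Obj J) \<and> finite (Arr J) \<and> is_functor J C F0 F1 \<longrightarrow>
        (\<exists>L p. limit_cone J C F0 F1 L p))"

definition binary_product :: "('o, 'm) cat \<Rightarrow> 'o \<Rightarrow> 'o \<Rightarrow> 'o \<Rightarrow> 'm \<Rightarrow> 'm \<Rightarrow> bool" where
  "binary_product C X Y P p q \<longleftrightarrow>
     p \<in> hom C P X \<and> q \<in> hom C P Y \<and>
     (\<forall>W. \<forall>u\<in>hom C W X. \<forall>v\<in>hom C W Y.
        \<exists>!h. h \<in> hom C W P \<and> Comp C p h = u \<and> Comp C q h = v)"

text \<open>\<open>E\<close>, with evaluation \<open>e\<close> defined on the product \<open>(P, p, q)\<close> of \<open>E\<close> and \<open>Y\<close>, is an exponential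
  of \<open>Z\<close> by \<open>Y\<close>. The arrow \<open>h\<close> is \<open>g\<close> times the identity of \<open>Y\<close>.\<close>

definition exponential ::
  "('o, 'm) cat \<Rightarrow> 'o \<Rightarrow> 'o \<Rightarrow> 'o \<Rightarrow> 'o \<Rightarrow> 'm \<Rightarrow> 'm \<Rightarrow> 'm \<Rightarrow> bool" where
  "exponential C Y Z E P p q e \<longleftrightarrow>
     binary_product C E Y P p q \<and> e \<in> hom C P Z \<and>
     (\<forall>X Q r s f. binary_product C X Y Q r s \<and> f \<in> hom C Q Z \<longrightarrow>
        (\<exists>!g. g \<in> hom C X E \<and>
              (\<exists>h\<in>hom C Q P. Comp C p h = Comp C g r \<and> Comp C q h = s \<and> Comp C e h = f)))"

definition cartesian_closed :: "('o, 'm) cat \<Rightarrow> bool" where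
  "cartesian_closed C \<longleftrightarrow>
     (\<exists>T. terminal C T) \<and>
     (\<forall>X\<in>Obj C. \<forall>Y\<in>Obj C. \<exists>P p q. binary_product C X Y P p q) \<and>
     (\<forall>Y\<in>Obj C. \<forall>Z\<in>Obj C. \<exists>E P p q e. exponential C Y Z E P p q e)"

definition elementary_topos :: "('o, 'm) cat \<Rightarrow> bool" where
  "elementary_topos C \<longleftrightarrow>
     category C \<and> has_finite_limits C \<and> cartesian_closed C \<and>
     (\<exists>T \<Omega> t. subobject_classifier C T \<Omega> t)"


section \<open>Simplicial sets\<close>

text \<open>\<open>Delta m n\<close> is the set of monotone maps \<open>[m] \<rightarrow> [n]\<close>, where \<open>[n] = {..n}\<close>; like all maps
  below they are \<^const>\<open>undefined\<close> outside their domain, so that equality of maps is equality in HOL.\<close>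

definition Delta :: "nat \<Rightarrow> nat \<Rightarrow> (nat \<Rightarrow> nat) set" where
  "Delta m n = {\<alpha> \<in> {..m} \<rightarrow>\<^sub>E {..n}. mono_on {..m} \<alpha>}"

record 'a sset =
  simp :: "nat \<Rightarrow> 'a set"
  act :: "nat \<Rightarrow> nat \<Rightarrow> (nat \<Rightarrow> nat) \<Rightarrow> 'a \<Rightarrow> 'a"

text \<open>A presheaf on the simplex category: \<open>act X m n \<alpha>\<close> is the map \<open>X\<^sub>n \<rightarrow> X\<^sub>m\<close> induced by
  \<open>\<alpha> : [m] \<rightarrow> [n]\<close>.\<close>

definition simplicial_set :: "'a sset \<Rightarrow> bool" where
  "simplicial_set X \<longleftrightarrow>
     (\<forall>m n. act X m n \<in> Delta m n \<rightarrow>\<^sub>E (simp X n \<rightarrow>\<^sub>E simp X m)) \<and>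
     (\<forall>n. \<forall>x\<in>simp X n. act X n n (\<lambda>i\<in>{..n}. i) x = x) \<and>
     (\<forall>k m n. \<forall>\<alpha>\<in>Delta k m. \<forall>\<beta>\<in>Delta m n. \<forall>x\<in>simp X n.
        act X k n (compose {..k} \<beta> \<alpha>) x = act X k m \<alpha> (act X m n \<beta> x))"

definition simplicial_map :: "'a sset \<Rightarrow> 'b sset \<Rightarrow> (nat \<Rightarrow> 'a \<Rightarrow> 'b) \<Rightarrow> bool" where
  "simplicial_map X Y f \<longleftrightarrow>
     (\<forall>n. f n \<in> simp X n \<rightarrow>\<^sub>E simp Y n) \<and>
     (\<forall>m n. \<forall>\<alpha>\<in>Delta m n. \<forall>x\<in>simp X n. f m (act X m n \<alpha> x) = act Y m n \<alpha> (f n x))"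

definition degreewise_injective :: "'a sset \<Rightarrow> (nat \<Rightarrow> 'a \<Rightarrow> 'b) \<Rightarrow> bool" where
  "degreewise_injective X f \<longleftrightarrow> (\<forall>n. inj_on (f n) (simp X n))"

definition std_simplex :: "nat \<Rightarrow> (nat \<Rightarrow> nat) sset" where
  "std_simplex n = \<lparr>simp = (\<lambda>m. Delta m n),
     act = (\<lambda>k m. \<lambda>\<alpha>\<in>Delta k m. \<lambda>\<beta>\<in>Delta m n. compose {..k} \<beta> \<alpha>)\<rparr>"

definition representing_map :: "'a sset \<Rightarrow> nat \<Rightarrow> 'a \<Rightarrow> nat \<Rightarrow> (nat \<Rightarrow> nat) \<Rightarrow> 'a" where
  "representing_map X n x = (\<lambda>m. \<lambda>\<alpha>\<in>Delta m n. act X m n \<alpha> x)"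

definition degenerate :: "'a sset \<Rightarrow> nat \<Rightarrow> 'a \<Rightarrow> bool" where
  "degenerate X n x \<longleftrightarrow>
     (\<exists>m<n. \<exists>\<sigma>\<in>Delta n m. \<sigma> ` {..n} = {..m} \<and> (\<exists>y\<in>simp X m. x = act X n m \<sigma> y))"

definition nonsingular :: "'a sset \<Rightarrow> bool" where
  "nonsingular X \<longleftrightarrow>
     (\<forall>n. \<forall>x\<in>simp X n. \<not> degenerate X n x \<longrightarrow>
        degreewise_injective (std_simplex n) (representing_map X n x))"


section \<open>The categories of simplicial sets and of non-singular simplicial sets\<close>

text \<open>HOL has no type of all sets, so the category of sets is taken relative to a collection \<open>\<U>\<close> of
  small sets of elements of some type. The only requirements are that subsets of small sets are
  small and that some small set is infinite. They hold for the small sets of any Grothendieck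
  universe with an infinite member, and for all subsets of any infinite type.\<close>

definition small_sets :: "'a set set \<Rightarrow> bool" where
  "small_sets \<U> \<longleftrightarrow> (\<forall>A\<in>\<U>. Pow A \<subseteq> \<U>) \<and> (\<exists>A\<in>\<U>. infinite A)"

record 'a smap =
  src :: "'a sset"
  tgt :: "'a sset"
  app :: "nat \<Rightarrow> 'a \<Rightarrow> 'a"

definition sSet :: "'a set set \<Rightarrow> ('a sset, 'a smap) cat" where
  "sSet \<U> =
     \<lparr>Obj = {X. simplicial_set X \<and> (\<forall>n. simp X n \<in> \<U>)},
      Arr = {f. simplicial_set (src f) \<and> (\<forall>n. simp (src f) n \<in> \<U>) \<and>
                simplicial_set (tgt f) \<and> (\<forall>n. simp (tgt f) n \<in> \<U>) \<and>
                simplicial_map (src f) (tgt f) (app f)},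
      Dom = src,
      Cod = tgt,
      Id = (\<lambda>X. \<lparr>src = X, tgt = X, app = (\<lambda>n. \<lambda>x\<in>simp X n. x)\<rparr>),
      Comp = (\<lambda>g f. \<lparr>src = src f, tgt = tgt g,
                     app = (\<lambda>n. compose (simp (src f) n) (app g n) (app f n))\<rparr>)\<rparr>"

definition nsSet :: "'a set set \<Rightarrow> ('a sset, 'a smap) cat" where
  "nsSet \<U> = full_subcategory (sSet \<U>) nonsingular"


section \<open>Basic facts\<close>

lemma category_full_subcategory:
  assumes "category C" shows "category (full_subcategory C P)"
  using assms unfolding category_def full_subcategory_def hom_def by (simp, blast)

lemma Delta_id: "(\<lambda>i\<in>{..n}. i) \<in> Delta n n"
  by (auto simp: Delta_def mono_on_def)

lemma Delta_compose:
  assumes "\<alpha> \<in> Delta k m" "\<beta> \<in> Delta m n" shows "compose {..k} \<beta> \<alpha> \<in> Delta k n"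
proof -
  have le: "\<alpha> i \<le> m" if "i \<le> k" for i using assms that by (auto simp: Delta_def)
  then have "\<beta> (\<alpha> i) \<le> n" if "i \<le> k" for i using assms that by (auto simp: Delta_def)
  moreover have "\<beta> (\<alpha> i) \<le> \<beta> (\<alpha> j)" if "i \<le> j" "j \<le> k" for i j
    using assms that le[of i] le[of j] by (simp add: Delta_def monotone_on_def)
  ultimately show ?thesis by (simp add: Delta_def monotone_on_def compose_def PiE_iff)
qed

lemma simplicial_set_act:
  assumes "simplicial_set X" "\<alpha> \<in> Delta m n" "x \<in> simp X n"
  shows "act X m n \<alpha> x \<in> simp X m"
proof -
  have "act X m n \<in> Delta m n \<rightarrow>\<^sub>E (simp X n \<rightarrow>\<^sub>E simp X m)"
    using assms(1) by (simp add: simplicial_set_def)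
  from PiE_mem[OF PiE_mem[OF this assms(2)] assms(3)] show ?thesis .
qed

lemma simplicial_map_app:
  assumes "simplicial_map X Y f" "x \<in> simp X n"
  shows "f n x \<in> simp Y n"
proof -
  have "f n \<in> simp X n \<rightarrow>\<^sub>E simp Y n" using assms(1) by (simp add: simplicial_map_def)
  from PiE_mem[OF this assms(2)] show ?thesis .
qed

lemma simplicial_map_id:
  assumes "simplicial_set X" shows "simplicial_map X X (\<lambda>n. \<lambda>x\<in>simp X n. x)"
proof -
  have "act X m n \<alpha> x \<in> simp X m" if "\<alpha> \<in> Delta m n" "x \<in> simp X n" for m n \<alpha> x
    using assms that by (rule simplicial_set_act)
  then show ?thesis by (auto simp: simplicial_map_def)
qed

lemma simplicial_map_compose:
  assumes X: "simplicial_set X" and f: "simplicial_map X Y f" and g: "simplicial_map Y Z g"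
  shows "simplicial_map X Z (\<lambda>n. compose (simp X n) (g n) (f n))"
proof -
  have a: "act X m n \<alpha> x \<in> simp X m" if "\<alpha> \<in> Delta m n" "x \<in> simp X n" for m n \<alpha> x
    using X that by (rule simplicial_set_act)
  have fm: "f n x \<in> simp Y n" if "x \<in> simp X n" for n x
    using f that by (rule simplicial_map_app)
  have gm: "g n x \<in> simp Z n" if "x \<in> simp Y n" for n x
    using g that by (rule simplicial_map_app)
  show ?thesis
    using f g a fm gm unfolding simplicial_map_def by (auto simp: compose_def)
qed

lemma category_sSet: "category (sSet \<U>)"
proof -
  have fm: "f n x \<in> simp Y n" if "simplicial_map X Y f" "x \<in> simp X n" for f n x X and Y :: "'a sset"
    using that by (rule simplicial_map_app)
  have fe: "f n \<in> extensional (simp X n)" if "simplicial_map X Y f" for f n X and Y :: "'a sset"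
    using that unfolding simplicial_map_def PiE_def by blast
  have id1: "compose (simp X n) (f n) (\<lambda>x\<in>simp X n. x) = f n" if "simplicial_map X Y f"
    for f n X and Y :: "'a sset"
    using fe[OF that] by (auto simp: compose_def fun_eq_iff extensional_def)
  have id2: "compose (simp X n) (\<lambda>x\<in>simp Y n. x) (f n) = f n" if "simplicial_map X Y f"
    for f n X and Y :: "'a sset"
    using fe[OF that] fm[OF that] by (auto simp: compose_def fun_eq_iff extensional_def)
  have assoc: "compose (simp X n) h (compose (simp X n) g (f n)) =
      compose (simp X n) (compose (simp Y n) h g) (f n)" if "simplicial_map X Y f"
    for f n g h X and Y :: "'a sset"
    using fm[OF that] by (auto simp: compose_def fun_eq_iff)
  show ?thesis
    unfolding category_def
  proof (intro conjI)
    show "\<forall>f\<in>Arr (sSet \<U>). Dom (sSet \<U>) f \<in> Obj (sSet \<U>) \<and> Cod (sSet \<U>) f \<in> Obj (sSet \<U>)"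
      by (simp add: sSet_def)
    show "\<forall>X\<in>Obj (sSet \<U>). Id (sSet \<U>) X \<in> hom (sSet \<U>) X X"
      by (simp add: sSet_def hom_def simplicial_map_id)
    show "\<forall>X Y Z. \<forall>f\<in>hom (sSet \<U>) X Y. \<forall>g\<in>hom (sSet \<U>) Y Z.
        Comp (sSet \<U>) g f \<in> hom (sSet \<U>) X Z"
      by (auto simp: sSet_def hom_def intro: simplicial_map_compose)
    show "\<forall>X Y. \<forall>f\<in>hom (sSet \<U>) X Y. Comp (sSet \<U>) f (Id (sSet \<U>) X) = f \<and>
        Comp (sSet \<U>) (Id (sSet \<U>) Y) f = f"
      by (auto simp: sSet_def hom_def id1 id2)
    show "\<forall>W X Y Z. \<forall>f\<in>hom (sSet \<U>) W X. \<forall>g\<in>hom (sSet \<U>) X Y. \<forall>h\<in>hom (sSet \<U>) Y Z.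
        Comp (sSet \<U>) h (Comp (sSet \<U>) g f) = Comp (sSet \<U>) (Comp (sSet \<U>) h g) f"
      by (auto simp: sSet_def hom_def assoc)
  qed
qed

lemma category_nsSet: "category (nsSet \<U>)"
  unfolding nsSet_def by (rule category_full_subcategory[OF category_sSet])

lemma simplicial_set_std_simplex: "simplicial_set (std_simplex n)"
proof -
  have 1: "compose {..m} \<beta> (\<lambda>i\<in>{..m}. i) = \<beta>" if "\<beta> \<in> Delta m n" for m \<beta>
    using that by (auto simp: compose_def Delta_def fun_eq_iff PiE_iff extensional_def)
  have 2: "compose {..k} \<gamma> (compose {..k} \<beta> \<alpha>) = compose {..k} (compose {..m} \<gamma> \<beta>) \<alpha>"
    if "\<alpha> \<in> Delta k m" for k m \<alpha> \<beta> \<gamma>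
    using that by (auto simp: compose_def Delta_def fun_eq_iff PiE_iff Pi_iff)
  show ?thesis
    unfolding simplicial_set_def std_simplex_def
    by (auto simp: Delta_id Delta_compose 1 2)
qed

lemma simplicial_map_representing_map:
  assumes "simplicial_set X" "x \<in> simp X n"
  shows "simplicial_map (std_simplex n) X (representing_map X n x)"
    and "representing_map X n x n (\<lambda>i\<in>{..n}. i) = x"
proof -
  have a: "act X m n \<alpha> x \<in> simp X m" if "\<alpha> \<in> Delta m n" for m \<alpha>
    using simplicial_set_act[OF assms(1) that assms(2)] .
  then show "simplicial_map (std_simplex n) X (representing_map X n x)"
    using assms unfolding simplicial_map_def representing_map_def std_simplex_def simplicial_set_def
    by (auto simp: Delta_compose)
  show "representing_map X n x n (\<lambda>i\<in>{..n}. i) = x"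
    using assms by (simp add: representing_map_def Delta_id simplicial_set_def)
qed

text \<open>The terminal objects are the small isomorphic copies of the standard 0-simplex.\<close>

lemma Delta_0: "Delta m 0 = {\<lambda>i\<in>{..m}. 0}"
  by (auto simp: Delta_def mono_on_def PiE_iff extensional_def fun_eq_iff)

lemma singletons_terminal:
  assumes T: "T \<in> Obj (nsSet \<U>)" and t: "\<And>n. simp T n = {t n}"
  shows "terminal (nsSet \<U>) T"
  unfolding terminal_def
proof (intro conjI ballI)
  fix X assume X: "X \<in> Obj (nsSet \<U>)"
  then have sX: "simplicial_set X" by (simp add: nsSet_def full_subcategory_def sSet_def)
  have sT: "simplicial_set T" using T by (simp add: nsSet_def full_subcategory_def sSet_def)
  have aX: "act X m n \<alpha> x \<in> simp X m" if "\<alpha> \<in> Delta m n" "x \<in> simp X n" for m n \<alpha> x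
    using sX that by (rule simplicial_set_act)
  have aT: "act T m n \<alpha> (t n) = t m" if "\<alpha> \<in> Delta m n" for m n \<alpha>
    using sT that t unfolding simplicial_set_def by (metis PiE_mem singletonD singletonI)
  have map: "simplicial_map X T f \<longleftrightarrow> f = (\<lambda>n. \<lambda>x\<in>simp X n. t n)" for f
  proof
    assume "simplicial_map X T f"
    then have "f n \<in> simp X n \<rightarrow>\<^sub>E {t n}" for n
      unfolding simplicial_map_def using t by metis
    then show "f = (\<lambda>n. \<lambda>x\<in>simp X n. t n)"
      by (fastforce simp: fun_eq_iff PiE_iff extensional_def)
  next
    assume "f = (\<lambda>n. \<lambda>x\<in>simp X n. t n)"
    then show "simplicial_map X T f"
      using aX aT by (auto simp: simplicial_map_def t)
  qed
  show "\<exists>!f. f \<in> hom (nsSet \<U>) X T"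
  proof (rule ex1I)
    show "\<lparr>src = X, tgt = T, app = (\<lambda>n. \<lambda>x\<in>simp X n. t n)\<rparr> \<in> hom (nsSet \<U>) X T"
      using X T map by (simp add: nsSet_def full_subcategory_def sSet_def hom_def)
    fix f assume "f \<in> hom (nsSet \<U>) X T"
    then show "f = \<lparr>src = X, tgt = T, app = (\<lambda>n. \<lambda>x\<in>simp X n. t n)\<rparr>"
      using map by (auto simp: nsSet_def full_subcategory_def sSet_def hom_def)
  qed
qed (fact T)

lemma terminal_nsSet_iff:
  assumes U: "small_sets \<U>"
  shows "terminal (nsSet \<U>) T \<longleftrightarrow> T \<in> Obj (nsSet \<U>) \<and>
    (\<exists>f. simplicial_map (std_simplex 0) T f \<and>
         (\<forall>n. bij_betw (f n) (simp (std_simplex 0) n) (simp T n)))"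
    (is "?L \<longleftrightarrow> ?R")
proof
  assume L: ?L
  then have T: "T \<in> Obj (nsSet \<U>)" by (simp add: terminal_def)
  then have sT: "simplicial_set T" by (simp add: nsSet_def full_subcategory_def sSet_def)
  obtain A a where A: "A \<in> \<U>" "a \<in> A"
    using U unfolding small_sets_def by (metis finite.emptyI equals0I)
  then have aU: "{a} \<in> \<U>" using U by (auto simp: small_sets_def)
  define P where "P = \<lparr>simp = (\<lambda>_::nat. {a}), act = (\<lambda>m n. \<lambda>\<alpha>\<in>Delta m n. \<lambda>x\<in>{a}. a)\<rparr>"
  have sP: "simplicial_set P"
    by (auto simp: simplicial_set_def P_def Delta_id Delta_compose)
  have "nonsingular P"
    unfolding nonsingular_def
  proof (intro allI ballI impI)
    fix n x assume x: "x \<in> simp P n" and nd: "\<not> degenerate P n x"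
    have "degenerate P n x" if "0 < n"
      unfolding degenerate_def using that x
      by (intro exI[of _ 0] conjI bexI[of _ "\<lambda>i\<in>{..n}. 0"] bexI[of _ a]) (auto simp: P_def Delta_0)
    with nd have "n = 0" by auto
    then show "degreewise_injective (std_simplex n) (representing_map P n x)"
      by (simp add: degreewise_injective_def std_simplex_def Delta_0)
  qed
  then have P: "P \<in> Obj (nsSet \<U>)"
    using sP aU by (simp add: nsSet_def full_subcategory_def sSet_def P_def)
  have Pt: "terminal (nsSet \<U>) P"
    by (rule singletons_terminal[OF P, of "\<lambda>_. a"]) (simp add: P_def)
  obtain f where f: "f \<in> hom (nsSet \<U>) P T" using L P unfolding terminal_def by blast
  obtain g where g: "g \<in> hom (nsSet \<U>) T P" using Pt T unfolding terminal_def by blast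
  have "Comp (nsSet \<U>) f g \<in> hom (nsSet \<U>) T T" "Id (nsSet \<U>) T \<in> hom (nsSet \<U>) T T"
    using category_nsSet[of \<U>] f g T unfolding category_def by blast+
  then have eq: "Comp (nsSet \<U>) f g = Id (nsSet \<U>) T"
    using L T unfolding terminal_def by blast
  have fg: "simplicial_map P T (app f)" "simplicial_map T P (app g)" "src g = T"
    using f g by (auto simp: nsSet_def full_subcategory_def sSet_def hom_def)
  have fa: "app f n a \<in> simp T n" for n
    using fg(1) unfolding simplicial_map_def P_def by (auto dest!: spec[of _ n])
  have "x = app f n a" if "x \<in> simp T n" for n x
  proof -
    have "app g n x \<in> {a}"
      using fg(2) that unfolding simplicial_map_def P_def by (metis PiE_mem sset.select_convs(1))
    moreover have "compose (simp T n) (app f n) (app g n) x = x"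
      using arg_cong[OF eq, of "\<lambda>h. app h n x"] that fg(3)
      by (simp add: nsSet_def full_subcategory_def sSet_def)
    ultimately show ?thesis using that by (simp add: compose_def)
  qed
  with fa have sing: "simp T n = {app f n a}" for n by blast
  have "bij_betw (representing_map T 0 (app f 0 a) n) (Delta n 0) (simp T n)" for n
  proof -
    have "representing_map T 0 (app f 0 a) n \<in> Delta n 0 \<rightarrow>\<^sub>E simp T n"
      using simplicial_map_representing_map(1)[OF sT fa[of 0]]
      by (simp add: simplicial_map_def std_simplex_def)
    then show ?thesis
      by (auto simp: bij_betw_def Delta_0 sing PiE_iff)
  qed
  then show ?R
    using T simplicial_map_representing_map(1)[OF sT fa[of 0]]
    by (auto simp: std_simplex_def)
next
  assume R: ?R
  then obtain f where f: "\<And>n. bij_betw (f n) (simp (std_simplex 0) n) (simp T n)" by blast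
  have "simp T n = {f n (\<lambda>i\<in>{..n}. 0)}" for n
    using f[of n] by (simp add: bij_betw_def std_simplex_def Delta_0)
  then show ?L
    using R singletons_terminal[of T \<U> "\<lambda>n. f n (\<lambda>i\<in>{..n}. 0)"] by blast
qed

end

theory Submission
  imports Defs
begin

text \<open>In a non-singular simplicial set, an edge whose two endpoints coincide cannot be
  non-degenerate, since its representing map identifies the two vertices of the 1-simplex; so it is
  the degenerate edge on its endpoint (\<open>nonsingular_loop_degenerate\<close>). In contrast, a subobject
  classifier needs loops that are not constant at the truth value \<open>t\<close>: classify the 0-skeleton of
  the 1-simplex, that is, its two endpoints. Both endpoints of the edge are sent to \<open>t\<close>, so the edge
  itself is sent to a loop at \<open>t\<close>. If \<open>\<Omega>\<close> is non-singular, this loop is the degenerate edge on \<open>t\<close>, so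
  the classifying map factors through \<open>t\<close>, and the subobject it classifies is the whole 1-simplex.
  But the 0-skeleton does not contain the non-degenerate edge.

  Two constructions make this precise inside the small non-singular simplicial sets. The 0-skeleton
  is the discrete simplicial set on the vertices. The 1-simplex has to be relabelled by elements
  of an infinite small set (\<open>ex_small_edge\<close>), which is possible because it is finite in each degree.\<close>


section \<open>Unfolding the category\<close>

lemma nsSet_Obj_iff:
  "X \<in> Obj (nsSet \<U>) \<longleftrightarrow> simplicial_set X \<and> nonsingular X \<and> (\<forall>n. simp X n \<in> \<U>)"
  by (auto simp: nsSet_def full_subcategory_def sSet_def)

lemma nsSet_hom_iff:
  "f \<in> hom (nsSet \<U>) X Y \<longleftrightarrow> X \<in> Obj (nsSet \<U>) \<and> Y \<in> Obj (nsSet \<U>) \<and>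
     src f = X \<and> tgt f = Y \<and> simplicial_map X Y (app f)"
  by (auto simp: nsSet_def full_subcategory_def sSet_def hom_def)

lemma nsSet_sel:
  "Dom (nsSet \<U>) f = src f" "Cod (nsSet \<U>) f = tgt f"
  "Comp (nsSet \<U>) g f = \<lparr>src = src f, tgt = tgt g,
     app = (\<lambda>n. compose (simp (src f) n) (app g n) (app f n))\<rparr>"
  by (auto simp: nsSet_def full_subcategory_def sSet_def)


section \<open>Constant operators\<close>

definition const_op :: "nat \<Rightarrow> nat \<Rightarrow> nat \<Rightarrow> nat" where
  "const_op m k = (\<lambda>i\<in>{..m}. k)"

lemma const_op_Delta: "k \<le> n \<Longrightarrow> const_op m k \<in> Delta m n"
  by (auto simp: const_op_def Delta_def mono_on_def)

lemma const_op_Delta_0: "const_op m 0 \<in> Delta m n"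
  by (rule const_op_Delta) simp

lemma compose_const_op:
  "\<alpha> \<in> Delta k m \<Longrightarrow> compose {..k} (const_op m j) \<alpha> = const_op k j"
  by (auto simp: const_op_def compose_def Delta_def fun_eq_iff PiE_iff)

lemma act_compose:
  assumes "simplicial_set X" "\<alpha> \<in> Delta k m" "\<beta> \<in> Delta m n" "x \<in> simp X n"
  shows "act X k m \<alpha> (act X m n \<beta> x) = act X k n (compose {..k} \<beta> \<alpha>) x"
  using assms unfolding simplicial_set_def by simp

lemma act_const_op_0_0:
  assumes "simplicial_set X" "x \<in> simp X 0"
  shows "act X 0 0 (const_op 0 0) x = x"
proof -
  have "const_op 0 0 = (\<lambda>i\<in>{..0}. i)"
    by (auto simp: const_op_def fun_eq_iff)
  with assms show ?thesis
    unfolding simplicial_set_def by metis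
qed

lemma simplicial_map_act:
  assumes "simplicial_map X Y f" "\<alpha> \<in> Delta m n" "x \<in> simp X n"
  shows "f m (act X m n \<alpha> x) = act Y m n \<alpha> (f n x)"
  using assms by (simp add: simplicial_map_def)

lemma simplicial_mapI:
  assumes "\<And>n x. x \<in> simp X n \<Longrightarrow> f n x \<in> simp Y n"
    and "\<And>n x. x \<notin> simp X n \<Longrightarrow> f n x = undefined"
    and "\<And>m n \<alpha> x. \<alpha> \<in> Delta m n \<Longrightarrow> x \<in> simp X n \<Longrightarrow> f m (act X m n \<alpha> x) = act Y m n \<alpha> (f n x)"
  shows "simplicial_map X Y f"
  using assms by (auto simp: simplicial_map_def PiE_iff extensional_def)


section \<open>Loops in non-singular simplicial sets\<close>

lemma nonsingular_loop_degenerate: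
  assumes X: "simplicial_set X" "nonsingular X" and c: "c \<in> simp X 1"
    and loop: "act X 0 1 (const_op 0 0) c = act X 0 1 (const_op 0 1) c"
  shows "c = act X 1 0 (const_op 1 0) (act X 0 1 (const_op 0 0) c)"
proof -
  have "const_op 0 0 \<in> Delta 0 1" "const_op 0 1 \<in> Delta 0 1"
    by (simp_all add: const_op_Delta)
  moreover have "const_op 0 0 0 \<noteq> const_op 0 1 0" by (simp add: const_op_def)
  ultimately have "\<not> inj_on (representing_map X 1 c 0) (simp (std_simplex 1) 0)"
    using loop by (fastforce simp: inj_on_def representing_map_def std_simplex_def)
  then have "degenerate X 1 c"
    using X c unfolding nonsingular_def degreewise_injective_def by blast
  then obtain \<sigma> y where y: "\<sigma> \<in> Delta 1 0" "y \<in> simp X 0" "c = act X 1 0 \<sigma> y"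
    unfolding degenerate_def by auto
  then have \<sigma>: "\<sigma> = const_op 1 0"
    by (simp add: Delta_0 const_op_def)
  have "act X 0 1 (const_op 0 0) c = y"
    using act_compose[OF X(1) const_op_Delta_0 const_op_Delta_0 y(2)]
      compose_const_op[OF const_op_Delta_0] act_const_op_0_0[OF X(1) y(2)]
    by (simp only: \<sigma> y(3))
  with y \<sigma> show ?thesis by simp
qed


section \<open>The standard simplices are non-singular\<close>

text \<open>A monotone map that is not injective takes equal values at some \<open>i\<close> and \<open>i + 1\<close>, so it factors
  through the degeneracy operator that merges these two.\<close>

lemma degenerate_std_simplex:
  assumes x: "x \<in> Delta m n" and ninj: "\<not> inj_on x {..m}"
  shows "degenerate (std_simplex n) m x"
proof -
  have mono: "x i \<le> x j" if "i \<le> j" "j \<le> m" for i j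
    using x that by (auto simp: Delta_def monotone_on_def)
  obtain i j where ij: "i < j" "j \<le> m" "x i = x j"
    using ninj by (metis atMost_iff inj_onI linorder_neqE_nat)
  then have eq: "x i = x (Suc i)"
    using mono[of i "Suc i"] mono[of "Suc i" j] by simp
  obtain k where k: "m = Suc k" using ij by (cases m) auto
  have ik: "i \<le> k" using ij k by simp
  define \<sigma> where "\<sigma> = (\<lambda>l\<in>{..m}. if l \<le> i then l else l - 1)"
  define y where "y = (\<lambda>l\<in>{..k}. x (if l \<le> i then l else Suc l))"
  have \<sigma>: "\<sigma> \<in> Delta m k"
    using ik k by (auto simp: \<sigma>_def Delta_def monotone_on_def)
  have surj: "\<sigma> ` {..m} = {..k}"
  proof
    show "\<sigma> ` {..m} \<subseteq> {..k}" using \<sigma> by (auto simp: Delta_def)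
    show "{..k} \<subseteq> \<sigma> ` {..m}"
    proof
      fix l assume "l \<in> {..k}"
      then have "l = \<sigma> (if l \<le> i then l else Suc l)" "(if l \<le> i then l else Suc l) \<in> {..m}"
        using k by (auto simp: \<sigma>_def)
      then show "l \<in> \<sigma> ` {..m}" by blast
    qed
  qed
  have xn: "x l \<le> n" if "l \<le> m" for l
    using x that by (auto simp: Delta_def)
  have y: "y \<in> Delta k n"
    using k mono xn by (auto simp: y_def Delta_def monotone_on_def)
  have "x l = compose {..m} y \<sigma> l" for l
  proof (cases "l \<le> m")
    case True
    consider "l \<le> i" | "l = Suc i" | "Suc i < l" by linarith
    then show ?thesis
      using True ik k eq by cases (auto simp: compose_def \<sigma>_def y_def)
  next
    case False
    then show ?thesis
      using x by (auto simp: compose_def Delta_def PiE_iff extensional_def)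
  qed
  then have "x = compose {..m} y \<sigma>" by blast
  with \<sigma> surj y k show ?thesis
    unfolding degenerate_def by (auto simp: std_simplex_def)
qed

lemma nonsingular_std_simplex: "nonsingular (std_simplex n)"
  unfolding nonsingular_def
proof (intro allI ballI impI)
  fix m x assume "x \<in> simp (std_simplex n) m" and nd: "\<not> degenerate (std_simplex n) m x"
  then have x: "x \<in> Delta m n" by (simp add: std_simplex_def)
  with nd have inj: "inj_on x {..m}" using degenerate_std_simplex by blast
  have "\<alpha> = \<beta>" if \<alpha>: "\<alpha> \<in> Delta k m" and \<beta>: "\<beta> \<in> Delta k m"
    and eq: "compose {..k} x \<alpha> = compose {..k} x \<beta>" for k \<alpha> \<beta>
  proof (rule PiE_ext)
    show "\<alpha> \<in> {..k} \<rightarrow>\<^sub>E {..m}" "\<beta> \<in> {..k} \<rightarrow>\<^sub>E {..m}" using \<alpha> \<beta> by (auto simp: Delta_def)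
    fix i assume i: "i \<in> {..k}"
    then have "x (\<alpha> i) = x (\<beta> i)" using fun_cong[OF eq, of i] by (simp add: compose_def)
    moreover have "\<alpha> i \<in> {..m}" "\<beta> i \<in> {..m}" using \<alpha> \<beta> i by (auto simp: Delta_def)
    ultimately show "\<alpha> i = \<beta> i" using inj by (simp add: inj_on_def)
  qed
  then show "degreewise_injective (std_simplex m) (representing_map (std_simplex n) m x)"
    using x by (auto simp: degreewise_injective_def inj_on_def representing_map_def std_simplex_def)
qed


section \<open>A small copy of the 1-simplex\<close>

definition relabel :: "(nat \<Rightarrow> 'b \<Rightarrow> 'a) \<Rightarrow> 'b sset \<Rightarrow> 'a sset" where
  "relabel e Y = \<lparr>simp = (\<lambda>n. e n ` simp Y n),
     act = (\<lambda>m n. \<lambda>\<alpha>\<in>Delta m n. \<lambda>x\<in>e n ` simp Y n.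
       e m (act Y m n \<alpha> (inv_into (simp Y n) (e n) x)))\<rparr>"

lemma simplicial_set_relabel:
  assumes Y: "simplicial_set Y" and e: "\<And>n. inj_on (e n) (simp Y n)"
  shows "simplicial_set (relabel e Y)"
    and "\<alpha> \<in> Delta m n \<Longrightarrow> y \<in> simp Y n \<Longrightarrow>
      act (relabel e Y) m n \<alpha> (e n y) = e m (act Y m n \<alpha> y)"
proof -
  have a: "act Y m n \<alpha> x \<in> simp Y m" if "\<alpha> \<in> Delta m n" "x \<in> simp Y n" for m n \<alpha> x
    using Y that by (rule simplicial_set_act)
  show act: "act (relabel e Y) m n \<alpha> (e n y) = e m (act Y m n \<alpha> y)"
    if "\<alpha> \<in> Delta m n" "y \<in> simp Y n" for m n \<alpha> y
    using that e by (simp add: relabel_def)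
  show "simplicial_set (relabel e Y)"
    unfolding simplicial_set_def
  proof (intro conjI allI ballI)
    show "act (relabel e Y) m n \<in> Delta m n \<rightarrow>\<^sub>E (simp (relabel e Y) n \<rightarrow>\<^sub>E simp (relabel e Y) m)" for m n
      using a e by (auto simp: relabel_def)
    show "act (relabel e Y) n n (\<lambda>i\<in>{..n}. i) x = x" if x: "x \<in> simp (relabel e Y) n" for n x
    proof -
      obtain y where y: "y \<in> simp Y n" "x = e n y" using x by (auto simp: relabel_def)
      then show ?thesis using Y act[OF Delta_id y(1)] by (simp add: simplicial_set_def)
    qed
    show "act (relabel e Y) k n (compose {..k} \<beta> \<alpha>) x =
        act (relabel e Y) k m \<alpha> (act (relabel e Y) m n \<beta> x)"
      if "\<alpha> \<in> Delta k m" "\<beta> \<in> Delta m n" and x: "x \<in> simp (relabel e Y) n" for k m n \<alpha> \<beta> x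
    proof -
      obtain y where y: "y \<in> simp Y n" "x = e n y" using x by (auto simp: relabel_def)
      then show ?thesis
        using that Y by (simp add: act a Delta_compose act_compose)
    qed
  qed
qed

text \<open>Relabelling is an isomorphism: a degeneracy of \<open>y\<close> is carried to one of its label, and the
  representing map of the label is that of \<open>y\<close> followed by the injective labelling.\<close>

lemma nonsingular_relabel:
  assumes Y: "simplicial_set Y" "nonsingular Y" and e: "\<And>n. inj_on (e n) (simp Y n)"
  shows "nonsingular (relabel e Y)"
  unfolding nonsingular_def
proof (intro allI ballI impI)
  note act = simplicial_set_relabel(2)[OF Y(1) e]
  fix n x assume x: "x \<in> simp (relabel e Y) n" and nd: "\<not> degenerate (relabel e Y) n x"
  obtain y where y: "y \<in> simp Y n" "x = e n y" using x by (auto simp: relabel_def)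
  have "\<not> degenerate Y n y"
  proof
    assume "degenerate Y n y"
    then obtain m \<sigma> z where z: "m < n" "\<sigma> \<in> Delta n m" "\<sigma> ` {..n} = {..m}" "z \<in> simp Y m"
      "y = act Y n m \<sigma> z"
      unfolding degenerate_def by blast
    then have "x = act (relabel e Y) n m \<sigma> (e m z)" by (simp add: y act)
    moreover have "e m z \<in> simp (relabel e Y) m" using z by (simp add: relabel_def)
    ultimately show False using nd z unfolding degenerate_def by blast
  qed
  then have inj: "inj_on (representing_map Y n y m) (Delta m n)" for m
    using Y y by (simp add: nonsingular_def degreewise_injective_def std_simplex_def)
  have "\<alpha> = \<beta>" if "\<alpha> \<in> Delta m n" "\<beta> \<in> Delta m n"
    and eq: "act (relabel e Y) m n \<alpha> x = act (relabel e Y) m n \<beta> x" for m \<alpha> \<beta>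
  proof -
    have "e m (act Y m n \<alpha> y) = e m (act Y m n \<beta> y)"
      using eq that y by (simp add: act)
    then have "act Y m n \<alpha> y = act Y m n \<beta> y"
      using e[of m] that y simplicial_set_act[OF Y(1)] by (metis inj_onD)
    then show ?thesis
      using inj[of m] that by (simp add: inj_on_def representing_map_def)
  qed
  then show "degreewise_injective (std_simplex n) (representing_map (relabel e Y) n x)"
    by (auto simp: degreewise_injective_def inj_on_def representing_map_def std_simplex_def)
qed

lemma finite_Delta: "finite (Delta m n)"
proof (rule finite_subset)
  show "Delta m n \<subseteq> {..m} \<rightarrow>\<^sub>E {..n}" by (auto simp: Delta_def)
qed (simp add: finite_PiE)

text \<open>Each degree of the 1-simplex is finite, so it can be labelled by elements of any infinite small
  set. The edge \<open>e\<close> is the label of the identity of \<open>[1]\<close>; by Yoneda, maps out of the copy are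
  determined by their value at \<open>e\<close>.\<close>

lemma ex_small_edge:
  assumes U: "small_sets \<U>"
  obtains X e where "X \<in> Obj (nsSet \<U>)" "e \<in> simp X 1"
    "\<And>n x. x \<in> simp X n \<Longrightarrow> \<exists>\<alpha>\<in>Delta n 1. x = act X n 1 \<alpha> e"
    "act X 0 1 (const_op 0 0) e \<noteq> act X 0 1 (const_op 0 1) e"
proof -
  obtain A where A: "A \<in> \<U>" "infinite A" using U by (auto simp: small_sets_def)
  have "\<exists>f. f ` Delta n 1 \<subseteq> A \<and> inj_on f (Delta n 1)" for n
  proof -
    obtain B where B: "finite B" "card B = card (Delta n 1)" "B \<subseteq> A"
      using infinite_arbitrarily_large[OF A(2)] by blast
    then obtain f where "bij_betw f (Delta n 1) B"
      using finite_same_card_bij[OF finite_Delta B(1)] by metis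
    then show ?thesis using B by (auto simp: bij_betw_def)
  qed
  then obtain l where l: "\<And>n. l n ` Delta n 1 \<subseteq> A" "\<And>n. inj_on (l n) (Delta n 1)" by metis
  let ?Y = "std_simplex 1" and ?X = "relabel l (std_simplex 1)" and ?i = "\<lambda>i\<in>{..1::nat}. i"
  have inj: "inj_on (l n) (simp ?Y n)" for n using l by (simp add: std_simplex_def)
  note act = simplicial_set_relabel(2)[OF simplicial_set_std_simplex inj]
  have act_i: "act ?X n 1 \<alpha> (l 1 ?i) = l n \<alpha>" if "\<alpha> \<in> Delta n 1" for n \<alpha>
  proof -
    have "compose {..n} ?i \<alpha> = \<alpha>"
      using that by (auto simp: compose_def Delta_def fun_eq_iff PiE_iff extensional_def)
    then show ?thesis
      using act[OF that, of ?i] that Delta_id[of 1] by (simp add: std_simplex_def)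
  qed
  show ?thesis
  proof
    have "l n ` Delta n 1 \<in> \<U>" for n using U A l(1)[of n] by (auto simp: small_sets_def)
    then have "simp ?X n \<in> \<U>" for n by (simp add: relabel_def std_simplex_def)
    then show "?X \<in> Obj (nsSet \<U>)"
      using simplicial_set_relabel(1)[OF simplicial_set_std_simplex inj]
        nonsingular_relabel[OF simplicial_set_std_simplex nonsingular_std_simplex inj]
      by (simp add: nsSet_Obj_iff)
    show "l 1 ?i \<in> simp ?X 1"
      using Delta_id[of 1] by (simp add: relabel_def std_simplex_def)
    show "\<exists>\<alpha>\<in>Delta n 1. x = act ?X n 1 \<alpha> (l 1 ?i)" if "x \<in> simp ?X n" for n x
      using that act_i by (auto simp: relabel_def std_simplex_def)
    have c: "const_op 0 0 \<in> Delta 0 1" "const_op 0 1 \<in> Delta 0 1"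
      by (auto simp: const_op_Delta)
    have "const_op 0 0 0 \<noteq> const_op 0 1 0" by (simp add: const_op_def)
    then have "l 0 (const_op 0 0) \<noteq> l 0 (const_op 0 1)"
      using c l(2)[of 0] by (metis inj_onD)
    then show "act ?X 0 1 (const_op 0 0) (l 1 ?i) \<noteq> act ?X 0 1 (const_op 0 1) (l 1 ?i)"
      using c by (simp only: act_i not_False_eq_True)
  qed
qed


section \<open>The 0-skeleton\<close>

definition discrete :: "'a set \<Rightarrow> 'a sset" where
  "discrete V = \<lparr>simp = (\<lambda>_. V), act = (\<lambda>m n. \<lambda>\<alpha>\<in>Delta m n. \<lambda>x\<in>V. x)\<rparr>"

lemma simplicial_set_discrete: "simplicial_set (discrete V)"
  by (auto simp: simplicial_set_def discrete_def Delta_id Delta_compose)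

text \<open>Every simplex of positive degree is a degeneracy of the vertex that it repeats.\<close>

lemma nonsingular_discrete: "nonsingular (discrete V)"
  unfolding nonsingular_def
proof (intro allI ballI impI)
  fix n x assume x: "x \<in> simp (discrete V) n" and nd: "\<not> degenerate (discrete V) n x"
  have "degenerate (discrete V) n x" if "0 < n"
    unfolding degenerate_def using that x
    by (intro exI[of _ 0] conjI bexI[of _ "\<lambda>i\<in>{..n}. 0"] bexI[of _ x]) (auto simp: discrete_def Delta_0)
  with nd have "n = 0" by auto
  then show "degreewise_injective (std_simplex n) (representing_map (discrete V) n x)"
    by (simp add: degreewise_injective_def std_simplex_def Delta_0)
qed

text \<open>A 0-skeleton consists of the degeneracies of the vertices. Representing a degeneracy by its
  vertex makes every operator act as the identity, so that the inclusion has to apply the constant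
  operator.\<close>

definition skeleton_incl :: "'a sset \<Rightarrow> 'a smap" where
  "skeleton_incl X = \<lparr>src = discrete (simp X 0), tgt = X,
     app = (\<lambda>n. \<lambda>v\<in>simp X 0. act X n 0 (const_op n 0) v)\<rparr>"

lemma act_skeleton_incl:
  assumes "simplicial_set X" "v \<in> simp X 0" "\<alpha> \<in> Delta m n"
  shows "act X m n \<alpha> (app (skeleton_incl X) n v) = app (skeleton_incl X) m v"
  using assms by (simp add: skeleton_incl_def act_compose const_op_Delta_0 compose_const_op)

lemma skeleton_incl_0:
  assumes "simplicial_set X" "v \<in> simp X 0"
  shows "app (skeleton_incl X) 0 v = v"
  using assms by (simp add: skeleton_incl_def act_const_op_0_0)

lemma skeleton_incl_hom:
  assumes X: "X \<in> Obj (nsSet \<U>)"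
  shows "skeleton_incl X \<in> hom (nsSet \<U>) (discrete (simp X 0)) X"
proof -
  have sX: "simplicial_set X" using X by (simp add: nsSet_Obj_iff)
  have "simplicial_map (discrete (simp X 0)) X (app (skeleton_incl X))"
  proof (rule simplicial_mapI)
    show "app (skeleton_incl X) n x \<in> simp X n" if "x \<in> simp (discrete (simp X 0)) n" for n x
      using that simplicial_set_act[OF sX const_op_Delta_0, of x 0 n]
      by (simp add: discrete_def skeleton_incl_def)
    show "app (skeleton_incl X) n x = undefined" if "x \<notin> simp (discrete (simp X 0)) n" for n x
      using that by (simp add: discrete_def skeleton_incl_def)
    show "app (skeleton_incl X) m (act (discrete (simp X 0)) m n \<alpha> x) =
        act X m n \<alpha> (app (skeleton_incl X) n x)"
      if "\<alpha> \<in> Delta m n" "x \<in> simp (discrete (simp X 0)) n" for m n \<alpha> x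
      using that sX by (simp add: discrete_def act_skeleton_incl)
  qed
  with X show ?thesis
    by (simp add: nsSet_hom_iff nsSet_Obj_iff simplicial_set_discrete nonsingular_discrete)
      (simp add: skeleton_incl_def discrete_def)
qed

lemma mono_arrow_nsSetI:
  assumes m: "m \<in> hom (nsSet \<U>) A X" and inj: "degreewise_injective A (app m)"
  shows "mono_arrow (nsSet \<U>) m"
  unfolding mono_arrow_def
proof (intro conjI allI ballI impI)
  show "m \<in> Arr (nsSet \<U>)" using m by (simp add: hom_def)
  fix W f g
  assume "f \<in> hom (nsSet \<U>) W (Dom (nsSet \<U>) m)" "g \<in> hom (nsSet \<U>) W (Dom (nsSet \<U>) m)"
    and eq: "Comp (nsSet \<U>) m f = Comp (nsSet \<U>) m g"
  then have f: "src f = W" "tgt f = A" "simplicial_map W A (app f)"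
    and g: "src g = W" "tgt g = A" "simplicial_map W A (app g)"
    using m by (auto simp: nsSet_hom_iff nsSet_sel)
  have PiE: "app f n \<in> simp W n \<rightarrow>\<^sub>E simp A n" "app g n \<in> simp W n \<rightarrow>\<^sub>E simp A n" for n
    using f(3) g(3) by (auto simp only: simplicial_map_def)
  have "app f n x = app g n x" if x: "x \<in> simp W n" for n x
  proof -
    have "compose (simp W n) (app m n) (app f n) x = compose (simp W n) (app m n) (app g n) x"
      using arg_cong[OF eq, of "\<lambda>h. app h n x"] f g by (simp add: nsSet_sel)
    then have "app m n (app f n x) = app m n (app g n x)"
      using x by (simp add: compose_def)
    then show ?thesis
      using inj simplicial_map_app[OF f(3) x] simplicial_map_app[OF g(3) x]
      unfolding degreewise_injective_def inj_on_def by blast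
  qed
  then have "app f n = app g n" for n
    using PiE_ext[OF PiE[of n]] by blast
  then have "app f = app g" by blast
  with f g show "f = g" by simp
qed

text \<open>A vertex is recovered from each of its degeneracies by restricting to any vertex of the simplex.\<close>

lemma mono_skeleton_incl:
  assumes X: "X \<in> Obj (nsSet \<U>)"
  shows "mono_arrow (nsSet \<U>) (skeleton_incl X)"
proof (rule mono_arrow_nsSetI[OF skeleton_incl_hom[OF X]])
  have sX: "simplicial_set X" using X by (simp add: nsSet_Obj_iff)
  have "v = act X 0 n (const_op 0 0) (app (skeleton_incl X) n v)" if "v \<in> simp X 0" for n v
    using that sX by (simp add: act_skeleton_incl const_op_Delta_0 skeleton_incl_0)
  then have "inj_on (app (skeleton_incl X) n) (simp X 0)" for n
    by (metis inj_onI)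
  then show "degreewise_injective (discrete (simp X 0)) (app (skeleton_incl X))"
    by (simp add: degreewise_injective_def discrete_def)
qed


section \<open>No subobject classifier\<close>

lemma terminal_nsSet_simp:
  assumes "small_sets \<U>" "terminal (nsSet \<U>) T"
  obtains \<tau> where "\<And>n. simp T n = {\<tau> n}"
proof -
  obtain f :: "nat \<Rightarrow> (nat \<Rightarrow> nat) \<Rightarrow> 'a"
    where "\<And>n. bij_betw (f n) (simp (std_simplex 0) n) (simp T n)"
    using assms terminal_nsSet_iff by metis
  then have "simp T n = {f n (\<lambda>i\<in>{..n}. 0)}" for n
    by (auto simp: bij_betw_def std_simplex_def Delta_0)
  then show ?thesis by (rule that)
qed

lemma no_subobject_classifier_nsSet:
  assumes U: "small_sets \<U>"
  shows "\<not> subobject_classifier (nsSet \<U>) T \<Omega> t"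
proof
  let ?C = "nsSet \<U>"
  assume cl: "subobject_classifier ?C T \<Omega> t"
  then have T: "terminal ?C T" and t: "t \<in> hom ?C T \<Omega>"
    by (auto simp: subobject_classifier_def)
  obtain \<tau> where \<tau>: "\<And>n. simp T n = {\<tau> n}" using terminal_nsSet_simp[OF U T] by blast
  have sT: "simplicial_set T" and s\<Omega>: "simplicial_set \<Omega>" "nonsingular \<Omega>"
    and tm: "simplicial_map T \<Omega> (app t)" and t_st: "src t = T" "tgt t = \<Omega>"
    using t by (auto simp: nsSet_hom_iff nsSet_Obj_iff)
  have t_act: "act \<Omega> m n \<alpha> (app t n (\<tau> n)) = app t m (\<tau> m)" if "\<alpha> \<in> Delta m n" for m n \<alpha>
  proof -
    have "act T m n \<alpha> (\<tau> n) = \<tau> m"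
      using simplicial_set_act[OF sT that, of "\<tau> n"] \<tau> by simp
    then show ?thesis using simplicial_map_act[OF tm that, of "\<tau> n"] \<tau> by simp
  qed

  obtain X e where X: "X \<in> Obj ?C" and e: "e \<in> simp X 1"
    and gen: "\<And>n x. x \<in> simp X n \<Longrightarrow> \<exists>\<alpha>\<in>Delta n 1. x = act X n 1 \<alpha> e"
    and ne: "act X 0 1 (const_op 0 0) e \<noteq> act X 0 1 (const_op 0 1) e"
    using ex_small_edge[OF U] by metis
  let ?B = "discrete (simp X 0)" and ?m = "skeleton_incl X"
  have sX: "simplicial_set X" using X by (simp add: nsSet_Obj_iff)
  have m: "src ?m = ?B" "tgt ?m = X" by (simp_all add: skeleton_incl_def)
  obtain \<chi> u where \<chi>: "\<chi> \<in> hom ?C X \<Omega>" and u: "u \<in> hom ?C ?B T"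
    and pb: "pullback_square ?C \<chi> t ?m u"
    using cl mono_skeleton_incl[OF X] m unfolding subobject_classifier_def
    by (metis nsSet_sel(1,2))
  have \<chi>m: "simplicial_map X \<Omega> (app \<chi>)" "src \<chi> = X" "tgt \<chi> = \<Omega>"
    and um: "simplicial_map ?B T (app u)" "src u = ?B"
    using \<chi> u by (auto simp: nsSet_hom_iff)

  have eq: "Comp ?C \<chi> ?m = Comp ?C t u" using pb by (simp add: pullback_square_def)
  have vertex: "app \<chi> 0 v = app t 0 (\<tau> 0)" if v: "v \<in> simp X 0" for v
  proof -
    have "compose (simp ?B 0) (app \<chi> 0) (app ?m 0) v = compose (simp ?B 0) (app t 0) (app u 0) v"
      using arg_cong[OF eq, of "\<lambda>h. app h 0 v"] m um by (simp add: nsSet_sel)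
    moreover have "v \<in> simp ?B 0" using v by (simp add: discrete_def)
    moreover have "app u 0 v = \<tau> 0"
      using simplicial_map_app[OF um(1) \<open>v \<in> simp ?B 0\<close>] \<tau> by simp
    ultimately show ?thesis using v sX by (simp add: compose_def skeleton_incl_0)
  qed
  have face: "act \<Omega> 0 1 (const_op 0 k) (app \<chi> 1 e) = app t 0 (\<tau> 0)" if "k \<le> 1" for k
  proof -
    have k: "const_op 0 k \<in> Delta 0 1" using that by (rule const_op_Delta)
    show ?thesis
      using simplicial_map_act[OF \<chi>m(1) k e] vertex[OF simplicial_set_act[OF sX k e]] by simp
  qed
  have c: "app \<chi> 1 e \<in> simp \<Omega> 1" using simplicial_map_app[OF \<chi>m(1) e] .
  have "app \<chi> 1 e = act \<Omega> 1 0 (const_op 1 0) (app t 0 (\<tau> 0))"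
    using nonsingular_loop_degenerate[OF s\<Omega> c] face[of 0] face[of 1] by simp
  then have \<chi>e: "app \<chi> 1 e = app t 1 (\<tau> 1)"
    using t_act const_op_Delta_0 by metis
  have \<chi>x: "app \<chi> n x = app t n (\<tau> n)" if "x \<in> simp X n" for n x
    using gen[OF that] simplicial_map_act[OF \<chi>m(1) _ e] \<chi>e t_act by metis

  \<comment> \<open>The identity of \<open>X\<close> and the map to \<open>T\<close> form a cone, so the 0-skeleton inclusion would have a
    section.\<close>
  define i where "i = Id ?C X"
  have i: "i \<in> hom ?C X X" using category_nsSet X unfolding category_def i_def by blast
  have i_app: "app i n x = x" if "x \<in> simp X n" for n x
    using that by (simp add: i_def nsSet_def full_subcategory_def sSet_def)
  have i_src: "src i = X" using i by (simp add: nsSet_hom_iff)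
  obtain v where v: "v \<in> hom ?C X T" using T X unfolding terminal_def by blast
  have vm: "simplicial_map X T (app v)" "src v = X" using v by (auto simp: nsSet_hom_iff)
  have "app v n x = \<tau> n" if "x \<in> simp X n" for n x
    using simplicial_map_app[OF vm(1) that] \<tau> by simp
  then have "compose (simp X n) (app \<chi> n) (app i n) = compose (simp X n) (app t n) (app v n)" for n
    by (auto simp: compose_def fun_eq_iff i_app \<chi>x)
  then have "Comp ?C \<chi> i = Comp ?C t v"
    using \<chi>m t_st vm i_src by (simp add: nsSet_sel)
  then obtain h where h: "h \<in> hom ?C X ?B" "Comp ?C ?m h = i"
    using pb i v \<chi>m(2) t_st m unfolding pullback_square_def by (metis nsSet_sel(1))
  have hm: "simplicial_map X ?B (app h)" "src h = X" using h by (auto simp: nsSet_hom_iff)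
  define w where "w = app h 1 e"
  have w: "w \<in> simp X 0"
    using simplicial_map_app[OF hm(1) e] by (simp add: w_def discrete_def)
  have "compose (simp X 1) (app ?m 1) (app h 1) e = e"
    using arg_cong[OF h(2), of "\<lambda>h. app h 1 e"] hm e by (simp add: nsSet_sel i_app)
  then have "e = app ?m 1 w" using e by (simp add: compose_def w_def)
  \<comment> \<open>An edge of the 0-skeleton has a single endpoint, but those of \<open>e\<close> differ.\<close>
  then have "act X 0 1 \<alpha> e = w" if "\<alpha> \<in> Delta 0 1" for \<alpha>
    using act_skeleton_incl[OF sX w that] skeleton_incl_0[OF sX w] by simp
  then show False using ne by (simp add: const_op_Delta)
qed

theorem mainTheorem6:
  fixes \<U> :: "'a set set"
  assumes "small_sets \<U>"
  shows "\<not> (\<exists>T \<Omega> t. subobject_classifier (nsSet \<U>) T \<Omega> t) \<and>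
         \<not> elementary_topos (nsSet \<U>)"
  using no_subobject_classifier_nsSet[OF assms] by (simp add: elementary_topos_def)

end
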